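(* Let $r$ and $m$ be positive integers, and put $n=rm$, $k=n-r$, $l=r^m$. Let $F$ be a finite field with $|F|\ge n$, let $\lambda_1,\dots,\lambda_n$ be distinct elements of $F$, and let $\gamma\in F\setminus\{0,1\}$. Let $$\mathcal C=\Big\{(C_1,\dots,C_n)\in (F^l)^n:\ \sum_{i=1}^n A_{t,i}C_i=0,\ t=0,1,\dots,r-1\Big\},$$ where the $l\times l$ matrices $A_{t,i}$ are those defined in the context. Then $\mathcal C$ has the optimal access property.
   Context: Conventions: $[n]=\{1,\dots,n\}$; $0^0=1$. Rows and columns of an $l\times l$ matrix $A$ are indexed by $0,1,\dots,l-1$, and $A(a,b)$ denotes the entry in row $a$, column $b$. An $(n,k,l)$ array code over $F$ (length $n$, dimension $k$, sub-packetization $l$) consists of $l\times n$ matrices $(C_1,\dots,C_n)\in(F^l)^n$, called codewords, with columns $C_i=(c_{i,0},\dots,c_{i,l-1})^T\in F^l$ (the $i$-th node). It is MDS if any $k$ of the $n$ columns $C_i$ of a codeword suffice to recover the remaining $n-k$ columns. Access. Let $\mathcal C$ be an $(n,k,l)$ MDS array code, $i\in[n]$ and $R\subseteq[n]\setminus\{i\}$ with $|R|\ge k$. Node $i$ can be repaired from the helper nodes $R$ by accessing $\omega$ symbols if there are numbers $\beta_{i,j},\omega_{i,j}$ ($j\in R$) with $\sum_{j\in R}\omega_{i,j}=\omega$, functions $f_{i,j}:F^l\to F^{\beta_{i,j}}$ ($j\in R$), where $f_{i,j}(C_j)$ depends on $\omega_{i,j}$ of the coordinates $c_{j,0},\dots,c_{j,l-1}$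 of $C_j$, and a function $g_i:F^{\sum_j\beta_{i,j}}\to F^l$ such that $C_i=g_i(f_{i,j}(C_j),j\in R)$ for all codewords. Let $\omega_i^*(R)$ be the smallest such $\omega$, and let $\omega(\mathcal C)=\max_{i\in[n]}\omega_i^*([n]\setminus\{i\})$. An $(n,k,l)$ MDS array code $\mathcal C$ has the optimal access property if $\omega(\mathcal C)=\frac{(n-1)l}{n-k}$. The matrices $A_{t,i}$. For an integer $a$ with $0\le a\le l-1$, write its $r$-ary expansion as $a=(a_m,\dots,a_1)$, i.e. $a=\sum_{v=1}^m a_v r^{v-1}$ with $0\le a_v\le r-1$. For $v\in[m]$ and $0\le u\le r-1$ let $a(v,u)$ be the integer obtained from $a$ by replacing the digit $a_v$ by $u$ and keeping all other digits. Each $i\in[n]$ is written uniquely as $i=(v-1)r+u+1$ with $v\in[m]$, $u\in\{0,\dots,r-1\}$. For $t=0,\dots,r-1$ and $0\le a,b\le l-1$, $$A_{t,(v-1)r+u+1}(a,b)=\begin{cases}\lambda_{(v-1)r+u+1}^t & \text{if } a_v<u,\ b=a,\\ \gamma\lambda_{(v-1)r+u+1}^t & \text{if } a_v>u,\ b=a,\\ \lambda_{(v-1)r+w+1}^t & \text{if } a_v=u,\ b=a(v,w)\text{ for some } w\in\{0,1,\dots,r-1\},\\ 0&\text{otherwise.}\end{cases}$$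
   Formalization: The case m = 1 with r ≥ 2 is excluded: there k = 0, the code contains only the zero codeword and is repaired by accessing 0 symbols, whereas (n-1)l/(n-k) = r-1 > 0, so the claim is false in that case. *)

theory Defs
  imports "Jordan_Normal_Form.Matrix" "HOL-Library.FuncSet" "HOL-Library.Cardinality" "HOL.Real"
begin

section \<open>Array codes\<close>

text \<open>
  A codeword is an extensional function on the node set \<open>{1..n}\<close> whose value at \<open>i\<close> is the
  \<open>i\<close>-th column, a vector of dimension \<open>l\<close> (coordinates \<open>0, ..., l - 1\<close>).
  Codes are not required to be linear; dimension \<open>k\<close> means that there are
  \<open>q ^ (k * l)\<close> codewords, where \<open>q\<close> is the size of the field.
\<close>

definition array_code ::
    "nat \<Rightarrow> nat \<Rightarrow> nat \<Rightarrow> (nat \<Rightarrow> 'a :: {field, finite} vec) set \<Rightarrow> bool" where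
  "array_code n k l C \<longleftrightarrow>
     k \<le> n \<and> C \<subseteq> ({1..n} \<rightarrow>\<^sub>E carrier_vec l) \<and> card C = CARD('a) ^ (k * l)"

definition mds_array_code ::
    "nat \<Rightarrow> nat \<Rightarrow> nat \<Rightarrow> (nat \<Rightarrow> 'a :: {field, finite} vec) set \<Rightarrow> bool" where
  "mds_array_code n k l C \<longleftrightarrow>
     array_code n k l C \<and>
     (\<forall>S. S \<subseteq> {1..n} \<and> card S = k \<longrightarrow>
        (\<exists>g. \<forall>c\<in>C. restrict c ({1..n} - S) = g (restrict c S)))"

section \<open>Repair by accessing symbols\<close>

definition depends_on_coords :: "nat \<Rightarrow> nat \<Rightarrow> ('a vec \<Rightarrow> 'b) \<Rightarrow> bool" where
  "depends_on_coords l w f \<longleftrightarrow>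
     (\<exists>T. T \<subseteq> {0..<l} \<and> card T = w \<and>
        (\<forall>x\<in>carrier_vec l. \<forall>y\<in>carrier_vec l. (\<forall>a\<in>T. x $ a = y $ a) \<longrightarrow> f x = f y))"

text \<open>
  The space of dimension \<open>\<Sum>j\<in>R. \<beta> j\<close> on which the reconstruction function \<open>g\<close> is defined is
  represented as the product over \<open>j \<in> R\<close> of the spaces of dimension \<open>\<beta> j\<close>.
\<close>

definition repairable_by_accessing ::
    "nat \<Rightarrow> (nat \<Rightarrow> 'a vec) set \<Rightarrow> nat \<Rightarrow> nat set \<Rightarrow> nat \<Rightarrow> bool" where
  "repairable_by_accessing l C i R \<omega> \<longleftrightarrow>
     (\<exists>(\<beta> :: nat \<Rightarrow> nat) (w :: nat \<Rightarrow> nat) (f :: nat \<Rightarrow> 'a vec \<Rightarrow> 'a vec)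
        (g :: (nat \<Rightarrow> 'a vec) \<Rightarrow> 'a vec).
        (\<Sum>j\<in>R. w j) = \<omega> \<and>
        (\<forall>j\<in>R. f j \<in> carrier_vec l \<rightarrow> carrier_vec (\<beta> j) \<and> depends_on_coords l (w j) (f j)) \<and>
        g \<in> (\<Pi>\<^sub>E j\<in>R. carrier_vec (\<beta> j)) \<rightarrow> carrier_vec l \<and>
        (\<forall>c\<in>C. c i = g (\<lambda>j\<in>R. f j (c j))))"

text \<open>
  The following two values are meaningful for an MDS array code of dimension \<open>k\<close>, a node
  \<open>i \<in> {1..n}\<close> and helpers \<open>R \<subseteq> {1..n} - {i}\<close> with \<open>card R \<ge> k\<close>: then accessing all symbols
  of all helpers repairs node \<open>i\<close>, so that the minimum exists.
\<close>

definition min_access :: "nat \<Rightarrow> (nat \<Rightarrow> 'a vec) set \<Rightarrow> nat \<Rightarrow> nat set \<Rightarrow> nat" where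
  "min_access l C i R = (LEAST \<omega>. repairable_by_accessing l C i R \<omega>)"

definition code_access :: "nat \<Rightarrow> nat \<Rightarrow> (nat \<Rightarrow> 'a vec) set \<Rightarrow> nat" where
  "code_access n l C = (MAX i\<in>{1..n}. min_access l C i ({1..n} - {i}))"

definition optimal_access ::
    "nat \<Rightarrow> nat \<Rightarrow> nat \<Rightarrow> (nat \<Rightarrow> 'a :: {field, finite} vec) set \<Rightarrow> bool" where
  "optimal_access n k l C \<longleftrightarrow>
     mds_array_code n k l C \<and>
     real (code_access n l C) = (real n - 1) * real l / (real n - real k)"

section \<open>The code given by parity-check matrices\<close>

text \<open>Digits are numbered from \<open>1\<close> (least significant) to \<open>m\<close>.\<close>

definition digit :: "nat \<Rightarrow> nat \<Rightarrow> nat \<Rightarrow> nat" where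
  "digit r a v = (a div r ^ (v - 1)) mod r"

definition replace_digit :: "nat \<Rightarrow> nat \<Rightarrow> nat \<Rightarrow> nat \<Rightarrow> nat \<Rightarrow> nat" where
  "replace_digit r m a v u = (\<Sum>j=1..m. (if j = v then u else digit r a j) * r ^ (j - 1))"

text \<open>
  The pair \<open>(v, u)\<close> below is the one with \<open>i = (v - 1) * r + u + 1\<close>. In the third case, the
  number \<open>w\<close> for which \<open>b\<close> arises from \<open>a\<close> by replacing the \<open>v\<close>-th digit is \<open>digit r b v\<close>.
\<close>

definition parity_mat ::
    "nat \<Rightarrow> nat \<Rightarrow> (nat \<Rightarrow> 'a :: field) \<Rightarrow> 'a \<Rightarrow> nat \<Rightarrow> nat \<Rightarrow> 'a mat" where
  "parity_mat r m lam \<gamma> t i = mat (r ^ m) (r ^ m) (\<lambda>(a, b).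
     let v = (i - 1) div r + 1; u = (i - 1) mod r in
       if digit r a v < u \<and> b = a then lam i ^ t
       else if digit r a v > u \<and> b = a then \<gamma> * lam i ^ t
       else if digit r a v = u \<and> (\<exists>w<r. b = replace_digit r m a v w)
         then lam ((v - 1) * r + digit r b v + 1) ^ t
       else 0)"

definition parity_code ::
    "nat \<Rightarrow> nat \<Rightarrow> (nat \<Rightarrow> 'a :: field) \<Rightarrow> 'a \<Rightarrow> (nat \<Rightarrow> 'a vec) set" where
  "parity_code r m lam \<gamma> =
     {C \<in> {1..r * m} \<rightarrow>\<^sub>E carrier_vec (r ^ m).
        \<forall>t<r. finsum_vec TYPE('a) (r ^ m) (\<lambda>i. parity_mat r m lam \<gamma> t i *\<^sub>v C i) {1..r * m}
                = 0\<^sub>v (r ^ m)}"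

end

(* Equation a of the code involves the unknown symbols only through the Vandermonde vectors
   (lam_j^t)_{t<r}. Hence r erased nodes are recovered row by row, in the order of the number of
   digit positions v at which node (v, a_v) is erased; pairs of rows are coupled by 2x2 systems
   that are regular since gamma is not 1, and gamma not 0 lets the remaining symbols be read off.
   For the repair of node (v, u) the rows a with a_v = u suffice, which touch a fraction 1/r of
   each helper. Conversely, in any MDS code r helpers must together supply l symbols when the
   other k - 1 helpers are fixed; averaging over the r-subsets gives the matching lower bound. *)
theory Submission
  imports Defs "HOL-Computational_Algebra.Polynomial"
begin

section \<open>Vandermonde systems\<close>

text \<open>Weight the equations with the coefficients of the polynomial \<open>p\<close> that
  vanishes at every \<open>x j\<close> except \<open>x i\<close>. Its degree is
  \<open>card S - 1\<close>, so the given powers suffice, and only the term of \<open>i\<close>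
  survives.\<close>

lemma vandermonde_kernel_trivial:
  fixes x d :: "'b \<Rightarrow> 'a :: field"
  assumes fin: "finite S" and inj: "inj_on x S"
    and eq: "\<And>t. t < card S \<Longrightarrow> (\<Sum>j\<in>S. x j ^ t * d j) = 0"
    and i: "i \<in> S"
  shows "d i = 0"
proof -
  define p where "p = (\<Prod>j\<in>S - {i}. [:- x j, 1:])"
  have "degree p \<le> (\<Sum>j\<in>S - {i}. degree [:- x j, 1:])"
    using degree_prod_sum_le[of "S - {i}" "\<lambda>j. [:- x j, 1:]"] fin by (simp add: p_def)
  also have "\<dots> = card S - 1"
    using fin i by simp
  finally have deg: "degree p < card S"
    using fin i by (metis One_nat_def Suc_pred card_gt_0_iff empty_iff le_imp_less_Suc)
  have poly_p: "poly p y = (\<Prod>j\<in>S - {i}. y - x j)" for y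
    by (simp add: p_def poly_prod)
  have "0 = (\<Sum>t\<le>degree p. coeff p t * (\<Sum>j\<in>S. x j ^ t * d j))"
    using eq deg by simp
  also have "\<dots> = (\<Sum>j\<in>S. poly p (x j) * d j)"
    by (simp add: poly_altdef sum_distrib_left sum_distrib_right mult.assoc
        sum.swap[of _ "{..degree p}"])
  also have "\<dots> = (\<Sum>j\<in>S. if j = i then poly p (x i) * d i else 0)"
    using fin by (intro sum.cong) (auto simp: poly_p)
  also have "\<dots> = poly p (x i) * d i"
    using fin i by simp
  finally have "poly p (x i) * d i = 0" by simp
  moreover have "poly p (x i) \<noteq> 0"
    using fin i inj by (auto simp: poly_p inj_on_def)
  ultimately show ?thesis by simp
qed

section \<open>The access lower bound for MDS array codes\<close>

lemma card_carrier_vec: "card (carrier_vec l :: 'a :: finite vec set) = CARD('a) ^ l"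
  and finite_carrier_vec: "finite (carrier_vec l :: 'a :: finite vec set)"
proof -
  have "bij_betw (\<lambda>f. vec l f :: 'a vec) ({..<l} \<rightarrow>\<^sub>E UNIV) (carrier_vec l)"
  proof (rule bij_betw_byWitness[where f' = "\<lambda>x. \<lambda>a\<in>{..<l}. x $ a"])
    show "\<forall>f\<in>{..<l} \<rightarrow>\<^sub>E UNIV. (\<lambda>a\<in>{..<l}. (vec l f :: 'a vec) $ a) = f"
      by (auto simp: restrict_def PiE_def extensional_def)
    show "\<forall>x\<in>carrier_vec l. vec l (\<lambda>a\<in>{..<l}. x $ a) = (x :: 'a vec)"
      by (auto intro!: eq_vecI)
    show "(\<lambda>f. vec l f :: 'a vec) ` ({..<l} \<rightarrow>\<^sub>E UNIV) \<subseteq> carrier_vec l"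
      by (intro image_subsetI vec_carrier)
    show "(\<lambda>x :: 'a vec. \<lambda>a\<in>{..<l}. x $ a) ` carrier_vec l \<subseteq> {..<l} \<rightarrow>\<^sub>E UNIV"
      by (intro image_subsetI restrict_PiE_iff[THEN iffD2]) simp
  qed
  from bij_betw_same_card[OF this] bij_betw_finite[OF this]
  show "card (carrier_vec l :: 'a vec set) = CARD('a) ^ l"
    and "finite (carrier_vec l :: 'a vec set)"
    by (simp_all add: card_PiE finite_PiE)
qed

text \<open>Recovery from \<open>S\<close> makes restriction injective. The code and the space of
  words on \<open>S\<close> have equally many elements, so any \<open>k\<close> columns can be
  prescribed freely.\<close>

lemma mds_restrict_bij:
  fixes C :: "(nat \<Rightarrow> 'a :: {field, finite} vec) set"
  assumes mds: "mds_array_code n k l C" and S: "S \<subseteq> {1..n}" "card S = k"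
  shows "bij_betw (\<lambda>c. restrict c S) C (S \<rightarrow>\<^sub>E carrier_vec l)"
proof -
  have C: "C \<subseteq> {1..n} \<rightarrow>\<^sub>E carrier_vec l" and card_C: "card C = CARD('a) ^ (k * l)"
    using mds unfolding mds_array_code_def array_code_def by blast+
  have "\<exists>g. \<forall>c\<in>C. restrict c ({1..n} - S) = g (restrict c S)"
    using mds S by (simp add: mds_array_code_def)
  then obtain g where g: "\<forall>c\<in>C. restrict c ({1..n} - S) = g (restrict c S)" ..
  have finS: "finite S" using S finite_subset by blast
  have inj: "inj_on (\<lambda>c. restrict c S) C"
  proof (rule inj_onI)
    fix c c' assume c: "c \<in> C" "c' \<in> C" and eq: "restrict c S = restrict c' S"
    have "c j = c' j" if "j \<in> {1..n}" for j
    proof (cases "j \<in> S")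
      case True
      then show ?thesis using fun_cong[OF eq, of j] by simp
    next
      case False
      have "restrict c ({1..n} - S) = restrict c' ({1..n} - S)"
        using g c eq by simp
      from fun_cong[OF this, of j] show ?thesis using False that by simp
    qed
    moreover have "c \<in> {1..n} \<rightarrow>\<^sub>E carrier_vec l" "c' \<in> {1..n} \<rightarrow>\<^sub>E carrier_vec l"
      using c C by blast+
    ultimately show "c = c'" by (intro PiE_ext)
  qed
  have "(\<lambda>c. restrict c S) ` C = S \<rightarrow>\<^sub>E carrier_vec l"
  proof (rule card_subset_eq)
    show "finite (S \<rightarrow>\<^sub>E (carrier_vec l :: 'a vec set))"
      using finS finite_carrier_vec by (intro finite_PiE) auto
    show "(\<lambda>c. restrict c S) ` C \<subseteq> S \<rightarrow>\<^sub>E carrier_vec l"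
      using C S by fastforce
    show "card ((\<lambda>c. restrict c S) ` C) = card (S \<rightarrow>\<^sub>E (carrier_vec l :: 'a vec set))"
      using finS S by (simp add: card_image[OF inj] card_C card_PiE card_carrier_vec
          flip: power_mult) (simp add: mult.commute)
  qed
  with inj show ?thesis by (simp add: bij_betw_def)
qed

text \<open>
  Fix the columns of \<open>J\<close> to be zero. By the MDS property column \<open>i\<close> still takes all values, so it
  cannot be determined by fewer than \<open>l\<close> symbols of the remaining helpers.
\<close>

lemma cut_set_bound:
  fixes C :: "(nat \<Rightarrow> 'a :: {field, finite} vec) set"
  assumes mds: "mds_array_code n k l C"
    and i: "i \<in> {1..n}" and R: "R \<subseteq> {1..n} - {i}" and J: "J \<subseteq> R" "Suc (card J) = k"
    and f: "\<And>j. j \<in> R \<Longrightarrow> depends_on_coords l (w j) (f j)"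
    and g: "\<And>c. c \<in> C \<Longrightarrow> c i = g (\<lambda>j\<in>R. f j (c j))"
  shows "l \<le> (\<Sum>j\<in>R - J. w j)"
proof -
  have finR: "finite R" using R finite_subset by blast
  have finJ: "finite J" using finR J finite_subset by blast
  have C: "C \<subseteq> {1..n} \<rightarrow>\<^sub>E carrier_vec l"
    using mds unfolding mds_array_code_def array_code_def by blast+
  \<comment> \<open>These \<open>k\<close> nodes can carry arbitrary columns: zero on
    \<open>J\<close> and any \<open>x\<close> at node \<open>i\<close>.\<close>
  define K where "K = insert i J"
  have K: "K \<subseteq> {1..n}" "card K = k"
    using i R J finJ by (auto simp: K_def card_insert_if)
  have surj: "\<exists>c\<in>C. restrict c K = y" if "y \<in> K \<rightarrow>\<^sub>E carrier_vec l" for y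
    using mds_restrict_bij[OF mds K] that unfolding bij_betw_def by (metis imageE)
  have "\<exists>c\<in>C. c i = x \<and> (\<forall>j\<in>J. c j = 0\<^sub>v l)" if "x \<in> carrier_vec l" for x :: "'a vec"
  proof -
    have "(\<lambda>j\<in>K. if j = i then x else 0\<^sub>v l) \<in> K \<rightarrow>\<^sub>E carrier_vec l"
      using that by auto
    from surj[OF this] obtain c
      where c: "c \<in> C" "restrict c K = (\<lambda>j\<in>K. if j = i then x else 0\<^sub>v l)" by blast
    have "c j = (if j = i then x else 0\<^sub>v l)" if "j \<in> K" for j
      using fun_cong[OF c(2), of j] that by simp
    moreover have "i \<notin> J" using R J by auto
    ultimately show ?thesis using c(1) by (intro bexI[of _ c]) (auto simp: K_def)
  qed
  then obtain cw where cw: "\<And>x. x \<in> carrier_vec l \<Longrightarrow>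
      cw x \<in> C \<and> cw x i = x \<and> (\<forall>j\<in>J. cw x j = 0\<^sub>v l)" by metis
  have "\<forall>j\<in>R. \<exists>T. T \<subseteq> {0..<l} \<and> card T = w j \<and>
      (\<forall>x\<in>carrier_vec l. \<forall>y\<in>carrier_vec l. (\<forall>a\<in>T. x $ a = y $ a) \<longrightarrow> f j x = f j y)"
    using f by (simp add: depends_on_coords_def)
  then obtain T where T: "\<And>j. j \<in> R \<Longrightarrow> T j \<subseteq> {0..<l}" "\<And>j. j \<in> R \<Longrightarrow> card (T j) = w j"
    "\<And>j x y. \<lbrakk>j \<in> R; x \<in> carrier_vec l; y \<in> carrier_vec l; \<forall>a\<in>T j. x $ a = y $ a\<rbrakk>
      \<Longrightarrow> f j x = f j y"
    by metis
  have finT: "finite (T j)" if "j \<in> R" for j using T(1)[OF that] finite_subset by blast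
  \<comment> \<open>The symbols read outside \<open>J\<close> from the codeword \<open>cw x\<close>.
    Helpers in \<open>J\<close> always send the same data, so \<open>h x\<close> determines
    \<open>x\<close>.\<close>
  define h where "h x = (\<lambda>j\<in>R - J. \<lambda>a\<in>T j. cw x j $ a)" for x
  have "inj_on h (carrier_vec l)"
  proof (rule inj_onI)
    fix x y :: "'a vec"
    assume x: "x \<in> carrier_vec l" and y: "y \<in> carrier_vec l" and eq: "h x = h y"
    have "f j (cw x j) = f j (cw y j)" if j: "j \<in> R" for j
    proof (cases "j \<in> J")
      case True
      then show ?thesis using cw x y by simp
    next
      case False
      then have "(\<lambda>a\<in>T j. cw x j $ a) = (\<lambda>a\<in>T j. cw y j $ a)"
        using fun_cong[OF eq, of j] j by (simp add: h_def)
      then have "\<forall>a\<in>T j. cw x j $ a = cw y j $ a" by (metis restrict_apply')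
      moreover have "cw x j \<in> carrier_vec l" "cw y j \<in> carrier_vec l"
        using cw[OF x] cw[OF y] C R j by auto
      ultimately show ?thesis using T(3)[OF j] by blast
    qed
    then have "(\<lambda>j\<in>R. f j (cw x j)) = (\<lambda>j\<in>R. f j (cw y j))" by auto
    then show "x = y" using g cw x y by metis
  qed
  moreover have "h ` carrier_vec l \<subseteq> (\<Pi>\<^sub>E j\<in>R - J. T j \<rightarrow>\<^sub>E UNIV)"
    by (auto simp: h_def)
  moreover have "finite (\<Pi>\<^sub>E j\<in>R - J. T j \<rightarrow>\<^sub>E (UNIV :: 'a set))"
    using finR finT by (intro finite_PiE) auto
  ultimately have "card (carrier_vec l :: 'a vec set)
      \<le> card (\<Pi>\<^sub>E j\<in>R - J. T j \<rightarrow>\<^sub>E (UNIV :: 'a set))"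
    by (metis card_inj_on_le)
  also have "\<dots> = (\<Prod>j\<in>R - J. CARD('a) ^ w j)"
    using finR finT T(2) by (simp add: card_PiE)
  finally have "CARD('a) ^ l \<le> CARD('a) ^ (\<Sum>j\<in>R - J. w j)"
    by (simp add: card_carrier_vec power_sum)
  moreover have "1 < CARD('a)"
  proof -
    have "card {0, 1 :: 'a} \<le> CARD('a)" by (intro card_mono) auto
    then show ?thesis by simp
  qed
  ultimately show ?thesis by (simp add: power_increasing_iff)
qed

text \<open>An element \<open>x\<close> of largest weight satisfies \<open>l \<le> r * w x\<close>,
  because some \<open>r\<close>-subset has weight at least \<open>l\<close>. Remove it and continue
  until \<open>R\<close> itself has \<open>r\<close> elements.\<close>

lemma sum_ge_of_subset_sums_ge:
  fixes w :: "'b \<Rightarrow> nat"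
  assumes "finite R" and "1 \<le> r" "r \<le> card R"
    and "\<And>X. \<lbrakk>X \<subseteq> R; card X = r\<rbrakk> \<Longrightarrow> l \<le> sum w X"
  shows "card R * l \<le> r * sum w R"
  using assms
proof (induction "card R - r" arbitrary: R)
  case 0
  then show ?case by simp
next
  case (Suc d)
  have "R \<noteq> {}" using Suc.prems by auto
  then have "Max (w ` R) \<in> w ` R" using Suc.prems(1) by simp
  then obtain x where x: "x \<in> R" "w x = Max (w ` R)" by auto
  then have x_max: "w y \<le> w x" if "y \<in> R" for y
    using Suc.prems(1) that by simp
  obtain X where X: "X \<subseteq> R" "card X = r"
    using Suc.prems(3) by (metis obtain_subset_with_card_n)
  have "l \<le> sum w X" using Suc.prems(4) X by simp
  also have "\<dots> \<le> (\<Sum>y\<in>X. w x)" using X x_max by (intro sum_mono) auto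
  finally have lx: "l \<le> r * w x" using X by simp
  have "card (R - {x}) * l \<le> r * sum w (R - {x})"
  proof (rule Suc.hyps(1))
    show "d = card (R - {x}) - r" "r \<le> card (R - {x})"
      using Suc.hyps(2) Suc.prems(1) x(1) by auto
    show "l \<le> sum w X" if "X \<subseteq> R - {x}" "card X = r" for X
      using that Suc.prems(4) by blast
  qed (use Suc.prems in auto)
  moreover have "card R = Suc (card (R - {x}))"
    using Suc.prems(1) x(1) by (metis card.remove)
  moreover have "sum w R = w x + sum w (R - {x})"
    using Suc.prems(1) x(1) by (metis sum.remove)
  ultimately show ?case using lx by (simp add: algebra_simps)
qed

text \<open>The complement in \<open>R\<close> of \<open>card R + 1 - k\<close> helpers has
  \<open>k - 1\<close> members, so by \<open>cut_set_bound\<close> these helpers supply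
  \<open>l\<close> symbols. For \<open>n - 1\<close> helpers the factor is
  \<open>n - k\<close>.\<close>

theorem mds_access_lower_bound:
  fixes C :: "(nat \<Rightarrow> 'a :: {field, finite} vec) set"
  assumes mds: "mds_array_code n k l C" and k: "1 \<le> k"
    and i: "i \<in> {1..n}" and R: "R \<subseteq> {1..n} - {i}" "k \<le> card R"
    and rep: "repairable_by_accessing l C i R \<omega>"
  shows "card R * l \<le> (card R + 1 - k) * \<omega>"
proof -
  obtain \<beta> w and f :: "nat \<Rightarrow> 'a vec \<Rightarrow> 'a vec" and g where w: "(\<Sum>j\<in>R. w j) = \<omega>"
    and f: "\<forall>j\<in>R. f j \<in> carrier_vec l \<rightarrow> carrier_vec (\<beta> j) \<and> depends_on_coords l (w j) (f j)"
    and g: "\<forall>c\<in>C. c i = g (\<lambda>j\<in>R. f j (c j))"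
    using rep unfolding repairable_by_accessing_def by (elim exE conjE) (rule that; assumption)
  have finR: "finite R" using R finite_subset by blast
  have "card R * l \<le> (card R + 1 - k) * sum w R"
  proof (rule sum_ge_of_subset_sums_ge[OF finR])
    fix X assume X: "X \<subseteq> R" "card X = card R + 1 - k"
    have "R - (R - X) = X" using X by auto
    moreover have "Suc (card (R - X)) = k"
      using X R k finR card_mono[OF finR X(1)] by (simp add: card_Diff_subset finite_subset)
    ultimately show "l \<le> sum w X"
      using cut_set_bound[OF mds i R(1), of "R - X" w f g] f g by auto
  qed (use k R in auto)
  then show ?thesis using w by simp
qed

section \<open>Digits\<close>

lemma digit_expansion_less:
  fixes d :: "nat \<Rightarrow> nat"
  assumes "\<And>j. j < m \<Longrightarrow> d j < r"
  shows "(\<Sum>j<m. d j * r ^ j) < r ^ m"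
  using assms
proof (induction m)
  case (Suc m)
  then have "(\<Sum>j<Suc m. d j * r ^ j) < r ^ m + d m * r ^ m" by simp
  also have "\<dots> = Suc (d m) * r ^ m" by simp
  also have "\<dots> \<le> r * r ^ m" using Suc.prems[of m] by (intro mult_le_mono1) simp
  finally show ?case by simp
qed simp

lemma digit_of_expansion:
  fixes d :: "nat \<Rightarrow> nat"
  assumes "\<And>j. j < m \<Longrightarrow> d j < r" and "v < m"
  shows "((\<Sum>j<m. d j * r ^ j) div r ^ v) mod r = d v"
  using assms
proof (induction m)
  case (Suc m)
  have r: "r > 0" using Suc.prems(1)[of m] by simp
  have less: "(\<Sum>j<m. d j * r ^ j) < r ^ m"
    using Suc.prems by (intro digit_expansion_less) simp
  show ?case
  proof (cases "v = m")
    case True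
    then show ?thesis using less Suc.prems r by simp
  next
    case False
    then have v: "v < m" using Suc.prems by simp
    then obtain e where m: "m = Suc (v + e)" by (auto dest: less_imp_Suc_add)
    \<comment> \<open>The top digit contributes a multiple of \<open>r ^ (v + 1)\<close>, invisible
      after division by \<open>r ^ v\<close> and reduction modulo \<open>r\<close>.\<close>
    have "(\<Sum>j<Suc m. d j * r ^ j) = (\<Sum>j<m. d j * r ^ j) + (d m * r ^ e * r) * r ^ v"
      by (simp add: m power_add)
    then have "(\<Sum>j<Suc m. d j * r ^ j) div r ^ v = (\<Sum>j<m. d j * r ^ j) div r ^ v + (d m * r ^ e) * r"
      using r by (simp del: sum.lessThan_Suc)
    then have "(\<Sum>j<Suc m. d j * r ^ j) div r ^ v mod r = (\<Sum>j<m. d j * r ^ j) div r ^ v mod r"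
      by simp
    also have "\<dots> = d v" using Suc.IH Suc.prems v by simp
    finally show ?thesis .
  qed
qed simp

lemma digit_expansion:
  fixes a :: nat
  shows "(\<Sum>j<m. (a div r ^ j mod r) * r ^ j) = a mod r ^ m"
proof (induction m)
  case (Suc m)
  have "a mod (r ^ m * r) = r ^ m * (a div r ^ m mod r) + a mod r ^ m"
    by (rule mod_mult2_eq)
  with Suc show ?case by (simp add: mult.commute)
qed simp

lemma replace_digit_altdef:
  "replace_digit r m a v u = (\<Sum>j<m. (if Suc j = v then u else digit r a (Suc j)) * r ^ j)"
  unfolding replace_digit_def by (simp add: sum.atLeast1_atMost_eq)

context
  fixes r m v u :: nat
  assumes u: "u < r"
begin

lemma replace_digit_less: "replace_digit r m a v u < r ^ m"
  unfolding replace_digit_altdef using u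
  by (intro digit_expansion_less) (simp add: digit_def)

lemma digit_replace_digit:
  assumes "j \<in> {1..m}"
  shows "digit r (replace_digit r m a v u) j = (if j = v then u else digit r a j)"
proof -
  obtain j' where j: "j = Suc j'" "j' < m" using assms by (cases j) auto
  show ?thesis
    unfolding replace_digit_altdef digit_def[of _ _ j] unfolding j
    using digit_of_expansion[of m "\<lambda>j. if Suc j = v then u else digit r a (Suc j)" r j'] u j
    by (simp add: digit_def)
qed

end

lemma replace_digit_self:
  assumes "a < r ^ m"
  shows "replace_digit r m a v (digit r a v) = a"
proof -
  have "replace_digit r m a v (digit r a v) = (\<Sum>j<m. (a div r ^ j mod r) * r ^ j)"
    unfolding replace_digit_altdef by (intro sum.cong) (auto simp: digit_def)
  then show ?thesis using assms by (simp add: digit_expansion)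
qed

lemma replace_digit_replace_digit:
  assumes "u < r"
  shows "replace_digit r m (replace_digit r m a v u) v w = replace_digit r m a v w"
  unfolding replace_digit_def[of _ _ "replace_digit r m a v u"]
  unfolding replace_digit_def[of _ _ a v w]
  using assms by (intro sum.cong) (auto simp: digit_replace_digit)

text \<open>Replacing digit \<open>v\<close> gives bijections between the \<open>r\<close> classes
  with a fixed \<open>v\<close>-th digit, so they share \<open>r ^ m\<close> equally. A repair reads
  one such class from every helper.\<close>

lemma card_digit_eq:
  assumes v: "v \<in> {1..m}" and u: "u < r"
  shows "card {a. a < r ^ m \<and> digit r a v = u} = r ^ (m - 1)"
proof -
  define T where "T w = {a. a < r ^ m \<and> digit r a v = w}" for w
  have fin: "finite (T w)" for w by (simp add: T_def)
  have eq: "card (T w) = card (T u)" if "w < r" for w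
    by (intro bij_betw_same_card[OF bij_betw_byWitness[where
        f = "\<lambda>a. replace_digit r m a v u" and f' = "\<lambda>a. replace_digit r m a v w"]])
      (use that u v in \<open>auto simp: T_def replace_digit_less digit_replace_digit
        replace_digit_replace_digit replace_digit_self\<close>)
  have "{..<r ^ m} = (\<Union>w<r. T w)"
    using u by (auto simp: T_def digit_def)
  then have "r ^ m = card (\<Union>w<r. T w)" by (metis card_lessThan)
  also have "\<dots> = (\<Sum>w<r. card (T w))"
    by (intro card_UN_disjoint) (auto simp: fin, auto simp: T_def)
  also have "\<dots> = r * card (T u)" using eq by simp
  also have "r ^ m = r * r ^ (m - 1)" using v by (cases m) simp_all
  finally have "r * r ^ (m - 1) = r * card (T u)" .
  then show ?thesis using u by (simp add: T_def)
qed

section \<open>Nodes as pairs of a digit position and a digit value\<close>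

definition block :: "nat \<Rightarrow> nat \<Rightarrow> nat" where
  "block r i = (i - 1) div r + 1"

definition pos :: "nat \<Rightarrow> nat \<Rightarrow> nat" where
  "pos r i = (i - 1) mod r"

definition node :: "nat \<Rightarrow> nat \<Rightarrow> nat \<Rightarrow> nat" where
  "node r v u = (v - 1) * r + u + 1"

lemma block_node: "\<lbrakk>1 \<le> v; u < r\<rbrakk> \<Longrightarrow> block r (node r v u) = v"
  by (simp add: block_def node_def)

lemma pos_node: "u < r \<Longrightarrow> pos r (node r v u) = u"
  by (simp add: pos_def node_def)

lemma node_block_pos: "1 \<le> i \<Longrightarrow> node r (block r i) (pos r i) = i"
  by (simp add: block_def pos_def node_def)

lemma pos_less: "1 \<le> r \<Longrightarrow> pos r i < r"
  by (simp add: pos_def)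

lemma node_mem:
  assumes "v \<in> {1..m}" "u < r"
  shows "node r v u \<in> {1..r * m}"
proof -
  have "node r v u \<le> (v - 1) * r + r" using assms by (simp add: node_def)
  also have "\<dots> = v * r" using assms by (cases v) auto
  also have "\<dots> \<le> r * m" using assms by simp
  finally show ?thesis by (simp add: node_def)
qed

lemma block_mem:
  assumes "i \<in> {1..r * m}"
  shows "block r i \<in> {1..m}"
proof -
  have "(i - 1) div r < m"
    using assms by (intro less_mult_imp_div_less) (auto simp: mult.commute)
  then show ?thesis by (simp add: block_def)
qed

text \<open>Turns sums over digit values into sums over nodes, and shows that a block has
  \<open>r\<close> nodes, as many as there are parity equations per row.\<close>

lemma block_eq_image:
  assumes "1 \<le> r" "v \<in> {1..m}"
  shows "{j \<in> {1..r * m}. block r j = v} = node r v ` {..<r}"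
proof (intro equalityI subsetI)
  fix j assume "j \<in> {j \<in> {1..r * m}. block r j = v}"
  then have "j = node r v (pos r j)" using node_block_pos[of j r] by auto
  then show "j \<in> node r v ` {..<r}" using pos_less[OF assms(1)] by blast
qed (use assms node_mem block_node in auto)

lemma inj_on_node: "inj_on (node r v) A"
  by (auto simp: inj_on_def node_def)

section \<open>Rows of the parity-check equations\<close>

text \<open>
  Row \<open>a\<close> of \<open>A_{t,i} x\<close> is \<open>\<Sum>j. lam j ^ t * row_coeff r m \<gamma> i j a x\<close>: the dependence on \<open>t\<close>
  is only through the Vandermonde vectors of the \<open>lam j\<close>.
\<close>

definition row_weight :: "nat \<Rightarrow> 'a :: field \<Rightarrow> nat \<Rightarrow> nat \<Rightarrow> 'a" where
  "row_weight r \<gamma> i a = (if digit r a (block r i) < pos r i then 1 else \<gamma>)"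

definition row_coeff ::
    "nat \<Rightarrow> nat \<Rightarrow> 'a :: field \<Rightarrow> nat \<Rightarrow> nat \<Rightarrow> nat \<Rightarrow> (nat \<Rightarrow> 'a) \<Rightarrow> 'a" where
  "row_coeff r m \<gamma> i j a x =
     (if digit r a (block r i) = pos r i
      then (if block r j = block r i then x (replace_digit r m a (block r i) (pos r j)) else 0)
      else (if j = i then row_weight r \<gamma> i a * x a else 0))"

lemma row_coeff_diff:
  "row_coeff r m \<gamma> i j a (\<lambda>b. x b - y b) = row_coeff r m \<gamma> i j a x - row_coeff r m \<gamma> i j a y"
  by (simp add: row_coeff_def algebra_simps)

text \<open>If digit \<open>v\<close> of \<open>a\<close> is \<open>u\<close>, the entry in the
  column obtained by replacing that digit with \<open>w\<close> carries the \<open>lam\<close> of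
  node \<open>(v, w)\<close>, and the sum over \<open>w\<close> becomes one over the block.
  Otherwise only the diagonal entry, with \<open>lam i\<close>, is left.\<close>

lemma parity_mat_row:
  fixes x :: "'a :: field vec"
  assumes r: "1 \<le> r" and i: "i \<in> {1..r * m}" and a: "a < r ^ m" and x: "x \<in> carrier_vec (r ^ m)"
  shows "(parity_mat r m lam \<gamma> t i *\<^sub>v x) $ a =
    (\<Sum>j\<in>{1..r * m}. lam j ^ t * row_coeff r m \<gamma> i j a (\<lambda>b. x $ b))"
proof -
  define v where "v = block r i"
  define u where "u = pos r i"
  have v: "v \<in> {1..m}" using i unfolding v_def by (rule block_mem)
  define A where "A b = (if digit r a v < u \<and> b = a then lam i ^ t
       else if digit r a v > u \<and> b = a then \<gamma> * lam i ^ t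
       else if digit r a v = u \<and> (\<exists>w<r. b = replace_digit r m a v w)
         then lam (node r v (digit r b v)) ^ t
       else 0)" for b
  have "(parity_mat r m lam \<gamma> t i *\<^sub>v x) $ a = (\<Sum>b<r ^ m. A b * x $ b)"
    using a x unfolding parity_mat_def A_def v_def u_def block_def pos_def node_def Let_def
    by (simp add: scalar_prod_def lessThan_atLeast0)
  also have "\<dots> = (\<Sum>j\<in>{1..r * m}. lam j ^ t * row_coeff r m \<gamma> i j a (\<lambda>b. x $ b))"
  proof (cases "digit r a v = u")
    case True
    have inj: "inj_on (replace_digit r m a v) {..<r}"
      using v by (intro inj_on_inverseI[where g = "\<lambda>b. digit r b v"]) (simp add: digit_replace_digit)
    have "(\<Sum>b<r ^ m. A b * x $ b) = (\<Sum>b\<in>replace_digit r m a v ` {..<r}. A b * x $ b)"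
      using True by (intro sum.mono_neutral_right) (auto simp: A_def replace_digit_less)
    also have "\<dots> = (\<Sum>w<r. lam (node r v w) ^ t * x $ replace_digit r m a v w)"
      unfolding sum.reindex[OF inj] using True v
      by (intro sum.cong) (auto simp: A_def digit_replace_digit)
    also have "\<dots> = (\<Sum>w<r. lam (node r v w) ^ t * row_coeff r m \<gamma> i (node r v w) a (\<lambda>b. x $ b))"
      using True v by (intro sum.cong)
        (auto simp: row_coeff_def pos_node block_node simp flip: v_def u_def)
    also have "\<dots> = (\<Sum>j\<in>node r v ` {..<r}. lam j ^ t * row_coeff r m \<gamma> i j a (\<lambda>b. x $ b))"
      by (simp add: sum.reindex[OF inj_on_node])
    also have "\<dots> = (\<Sum>j\<in>{1..r * m}. lam j ^ t * row_coeff r m \<gamma> i j a (\<lambda>b. x $ b))"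
      unfolding block_eq_image[OF r v, symmetric] using True
      by (intro sum.mono_neutral_left) (auto simp: row_coeff_def simp flip: v_def u_def)
    finally show ?thesis .
  next
    case False
    have "(\<Sum>b<r ^ m. A b * x $ b) = (\<Sum>b<r ^ m. if b = a then A a * x $ a else 0)"
      using False by (intro sum.cong) (auto simp: A_def)
    also have "\<dots> = A a * x $ a" using a by simp
    also have "\<dots> = lam i ^ t * row_coeff r m \<gamma> i i a (\<lambda>b. x $ b)"
      using False by (auto simp: A_def row_coeff_def row_weight_def simp flip: v_def u_def)
    also have "\<dots> = (\<Sum>j\<in>{1..r * m}. if j = i
        then lam i ^ t * row_coeff r m \<gamma> i i a (\<lambda>b. x $ b) else 0)"
      using i by simp
    also have "\<dots> = (\<Sum>j\<in>{1..r * m}. lam j ^ t * row_coeff r m \<gamma> i j a (\<lambda>b. x $ b))"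
      using False by (intro sum.cong) (auto simp: row_coeff_def simp flip: v_def u_def)
    finally show ?thesis .
  qed
  finally show ?thesis .
qed

text \<open>The multiplier of the Vandermonde vector of \<open>lam j\<close> in row
  \<open>a\<close>. Words are plain functions here, so that they can be subtracted
  pointwise.\<close>

definition vandermonde_coeff ::
    "nat \<Rightarrow> nat \<Rightarrow> 'a :: field \<Rightarrow> nat \<Rightarrow> nat \<Rightarrow> (nat \<Rightarrow> nat \<Rightarrow> 'a) \<Rightarrow> 'a" where
  "vandermonde_coeff r m \<gamma> j a c = (\<Sum>i\<in>{1..r * m}. row_coeff r m \<gamma> i j a (c i))"

lemma vandermonde_coeff_diff:
  "vandermonde_coeff r m \<gamma> j a (\<lambda>i b. c i b - c' i b) =
     vandermonde_coeff r m \<gamma> j a c - vandermonde_coeff r m \<gamma> j a c'"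
  by (simp add: vandermonde_coeff_def row_coeff_diff sum_subtractf)

text \<open>Row \<open>a\<close> of the left side of the \<open>t\<close>-th parity equation, with
  the sums over nodes exchanged.\<close>

definition syndrome ::
    "nat \<Rightarrow> nat \<Rightarrow> (nat \<Rightarrow> 'a :: field) \<Rightarrow> 'a \<Rightarrow> nat \<Rightarrow> nat \<Rightarrow> (nat \<Rightarrow> nat \<Rightarrow> 'a) \<Rightarrow> 'a" where
  "syndrome r m lam \<gamma> t a c = (\<Sum>j\<in>{1..r * m}. lam j ^ t * vandermonde_coeff r m \<gamma> j a c)"

lemma syndrome_diff:
  "syndrome r m lam \<gamma> t a (\<lambda>i b. c i b - c' i b) =
     syndrome r m lam \<gamma> t a c - syndrome r m lam \<gamma> t a c'"
  by (simp add: syndrome_def vandermonde_coeff_diff right_diff_distrib sum_subtractf)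

lemma parity_code_iff:
  fixes lam :: "nat \<Rightarrow> 'a :: field"
  assumes r: "1 \<le> r"
  shows "C \<in> parity_code r m lam \<gamma> \<longleftrightarrow> C \<in> {1..r * m} \<rightarrow>\<^sub>E carrier_vec (r ^ m) \<and>
    (\<forall>t<r. \<forall>a<r ^ m. syndrome r m lam \<gamma> t a (\<lambda>i b. C i $ b) = 0)"
proof -
  have "finsum_vec TYPE('a) (r ^ m) (\<lambda>i. parity_mat r m lam \<gamma> t i *\<^sub>v C i) {1..r * m} = 0\<^sub>v (r ^ m)
      \<longleftrightarrow> (\<forall>a<r ^ m. syndrome r m lam \<gamma> t a (\<lambda>i b. C i $ b) = 0)"
    (is "?s = _ \<longleftrightarrow> _")
    if C: "C \<in> {1..r * m} \<rightarrow>\<^sub>E carrier_vec (r ^ m)" for t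
  proof -
    have closed: "(\<lambda>i. parity_mat r m lam \<gamma> t i *\<^sub>v C i) \<in> {1..r * m} \<rightarrow> carrier_vec (r ^ m)"
      by (auto simp: parity_mat_def intro!: carrier_vecI)
    have "?s $ a = syndrome r m lam \<gamma> t a (\<lambda>i b. C i $ b)" if a: "a < r ^ m" for a
    proof -
      have "?s $ a = (\<Sum>i\<in>{1..r * m}. (parity_mat r m lam \<gamma> t i *\<^sub>v C i) $ a)"
        using a closed by (intro index_finsum_vec) auto
      also have "\<dots> = (\<Sum>i\<in>{1..r * m}. \<Sum>j\<in>{1..r * m}.
          lam j ^ t * row_coeff r m \<gamma> i j a (\<lambda>b. C i $ b))"
        using r a C by (intro sum.cong parity_mat_row) auto
      also have "\<dots> = syndrome r m lam \<gamma> t a (\<lambda>i b. C i $ b)"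
        unfolding syndrome_def vandermonde_coeff_def sum_distrib_left by (rule sum.swap)
      finally show ?thesis .
    qed
    moreover have "?s \<in> carrier_vec (r ^ m)" using closed by (rule finsum_vec_closed)
    ultimately show ?thesis by (auto simp: vec_eq_iff)
  qed
  then show ?thesis by (auto simp: parity_code_def)
qed

text \<open>Only two nodes can contribute: \<open>j\<close> itself and the node \<open>p\<close> of
  the same block whose position is the digit of \<open>a\<close> there. They coincide in the first
  case, where a digit is replaced by itself.\<close>

lemma vandermonde_coeff_eq:
  assumes r: "1 \<le> r" and a: "a < r ^ m" and j: "j \<in> {1..r * m}"
  shows "vandermonde_coeff r m \<gamma> j a c =
    (if digit r a (block r j) = pos r j then c j a
     else row_weight r \<gamma> j a * c j a +
       c (node r (block r j) (digit r a (block r j))) (replace_digit r m a (block r j) (pos r j)))"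
proof -
  define v where "v = block r j"
  define p where "p = node r v (digit r a v)"
  have v: "v \<in> {1..m}" using j unfolding v_def by (rule block_mem)
  have dig: "digit r a v < r" using r by (simp add: digit_def)
  have p: "p \<in> {1..r * m}" "block r p = v" "pos r p = digit r a v"
    using node_mem[OF v dig] v dig by (simp_all add: p_def block_node pos_node)
  have p_eq: "i = p" if "i \<in> {1..r * m}" "block r i = v" "pos r i = digit r a v" for i
    using that node_block_pos[of i r] by (simp add: p_def)
  have jp: "j = p \<longleftrightarrow> digit r a v = pos r j"
    using p_eq[of j] j p by (auto simp: v_def)
  have zero: "row_coeff r m \<gamma> i j a (c i) = 0" if "i \<in> {1..r * m} - {j, p}" for i
    using that p_eq[of i] by (auto simp: row_coeff_def v_def)
  have "vandermonde_coeff r m \<gamma> j a c = (\<Sum>i\<in>{j, p}. row_coeff r m \<gamma> i j a (c i))"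
    unfolding vandermonde_coeff_def using zero j p by (intro sum.mono_neutral_right) auto
  also have "\<dots> = (if digit r a v = pos r j then c j a
     else row_weight r \<gamma> j a * c j a + c p (replace_digit r m a v (pos r j)))"
  proof (cases "j = p")
    case True
    then show ?thesis
      using jp p replace_digit_self[OF a, of v] by (simp add: row_coeff_def)
  next
    case False
    then show ?thesis using jp p by (simp add: row_coeff_def flip: v_def)
  qed
  finally show ?thesis by (simp add: v_def p_def)
qed

section \<open>Recovering nodes\<close>

locale parity_check =
  fixes r m :: nat and lam :: "nat \<Rightarrow> 'a :: field" and \<gamma> :: 'a
  assumes r: "1 \<le> r" and m: "1 \<le> m"
    and inj_lam: "inj_on lam {1..r * m}" and \<gamma>: "\<gamma> \<noteq> 0" "\<gamma> \<noteq> 1"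
begin

text \<open>Once the coefficients outside \<open>S\<close> vanish, row \<open>a\<close> gives a
  square Vandermonde system in the \<open>r\<close> coefficients of \<open>S\<close>, with distinct
  \<open>lam j\<close>.\<close>

lemma vandermonde_coeff_zero:
  assumes S: "S \<subseteq> {1..r * m}" "card S = r"
    and syn: "\<And>t. t < r \<Longrightarrow> syndrome r m lam \<gamma> t a c = 0"
    and out: "\<And>j. j \<in> {1..r * m} - S \<Longrightarrow> vandermonde_coeff r m \<gamma> j a c = 0"
    and j: "j \<in> S"
  shows "vandermonde_coeff r m \<gamma> j a c = 0"
proof (rule vandermonde_kernel_trivial[where x = lam and S = S and
      d = "\<lambda>j. vandermonde_coeff r m \<gamma> j a c"])
  show "finite S" "inj_on lam S"
    using S inj_lam finite_subset inj_on_subset by blast+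
  fix t assume "t < card S"
  then have "0 = syndrome r m lam \<gamma> t a c" using syn S by simp
  also have "\<dots> = (\<Sum>j\<in>S. lam j ^ t * vandermonde_coeff r m \<gamma> j a c)"
    unfolding syndrome_def using S out by (intro sum.mono_neutral_right) auto
  finally show "(\<Sum>j\<in>S. lam j ^ t * vandermonde_coeff r m \<gamma> j a c) = 0" by simp
qed (rule j)

text \<open>
  Induction on the number of positions \<open>v\<close> of \<open>a\<close> whose node \<open>(v, a\<^sub>v)\<close> is erased. By the
  induction hypothesis only the Vandermonde vectors of erased nodes occur in row \<open>a\<close>. For two
  erased nodes \<open>(v, a\<^sub>v)\<close> and \<open>(v, w)\<close>, the rows \<open>a\<close> and \<open>a(v, w)\<close> then give two equations in
  two unknowns with determinant \<open>\<plusminus>(1 - \<gamma>)\<close>.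
\<close>

lemma erased_nodes_zero:
  assumes S: "S \<subseteq> {1..r * m}" "card S = r"
    and out: "\<And>i a. \<lbrakk>i \<in> {1..r * m} - S; a < r ^ m\<rbrakk> \<Longrightarrow> c i a = 0"
    and syn: "\<And>t a. \<lbrakk>t < r; a < r ^ m\<rbrakk> \<Longrightarrow> syndrome r m lam \<gamma> t a c = 0"
    and "i \<in> {1..r * m}" and "a < r ^ m"
  shows "c i a = 0"
proof -
  define E where "E a = {v \<in> {1..m}. node r v (digit r a v) \<in> S}" for a
  have finE: "finite (E a)" for a by (simp add: E_def)
  have "\<forall>i\<in>{1..r * m}. c i a = 0" using \<open>a < r ^ m\<close>
  proof (induction "card (E a)" arbitrary: a rule: less_induct)
    case less
    \<comment> \<open>Stated for every row \<open>b\<close> with as many erased positions as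
      \<open>a\<close>, since the partner row of a 2x2 system is needed too.\<close>
    have coeff_zero: "vandermonde_coeff r m \<gamma> j b c = 0"
      if b: "b < r ^ m" "card (E b) = card (E a)" and j: "j \<in> S" for b j
    proof (rule vandermonde_coeff_zero[OF S _ _ j])
      fix j assume j: "j \<in> {1..r * m} - S"
      define v where "v = block r j"
      have v: "v \<in> {1..m}" using j unfolding v_def by (intro block_mem) simp
      have nj: "node r v (pos r j) = j" using j by (simp add: v_def node_block_pos)
      have pj: "pos r j < r" using r by (rule pos_less)
      define p where "p = node r v (digit r b v)"
      define b' where "b' = replace_digit r m b v (pos r j)"
      have b': "b' < r ^ m" using pj unfolding b'_def by (rule replace_digit_less)
      have p: "p \<in> {1..r * m}"
        using r v unfolding p_def by (intro node_mem) (auto simp: digit_def)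
      have "c p b' = 0"
      proof (cases "p \<in> S")
        case True
        \<comment> \<open>Digit \<open>v\<close> of \<open>b'\<close> names the intact node
          \<open>j\<close>, so one erased position disappears and the induction hypothesis covers
          \<open>b'\<close>.\<close>
        have "E b' = E b - {v}"
          using v j nj pj by (auto simp: E_def b'_def digit_replace_digit split: if_splits)
        moreover have "v \<in> E b" using True v by (simp add: E_def p_def)
        ultimately have "card (E b') < card (E a)"
          using b(2) card_Diff1_less[OF finE, of v b] by simp
        then show ?thesis using less.hyps b' p by blast
      next
        case False
        then show ?thesis using out p b' by simp
      qed
      moreover have "c j b = 0" using out j b by simp
      ultimately show "vandermonde_coeff r m \<gamma> j b c = 0"
        using r b j by (simp add: vandermonde_coeff_eq flip: v_def p_def b'_def)
    qed (use syn b in auto)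
    have "c j a = 0" if j: "j \<in> S" for j
    proof -
      have j': "j \<in> {1..r * m}" using j S by auto
      define v where "v = block r j"
      define w where "w = pos r j"
      have v: "v \<in> {1..m}" using j' unfolding v_def by (rule block_mem)
      have nj: "node r v w = j" using j' by (simp add: v_def w_def node_block_pos)
      have w: "w < r" using r unfolding w_def by (rule pos_less)
      define s where "s = digit r a v"
      have s: "s < r" using r by (simp add: s_def digit_def)
      define p where "p = node r v s"
      have p: "p \<in> {1..r * m}" using v s unfolding p_def by (rule node_mem)
      have p': "block r p = v" "pos r p = s" using v s by (simp_all add: p_def block_node pos_node)
      \<comment> \<open>For \<open>s \<noteq> w\<close> the rows \<open>a\<close> and
        \<open>b\<close> are partners: the coefficient of \<open>j\<close> in row \<open>a\<close>
        and that of \<open>p\<close> in row \<open>b\<close> both involve just \<open>c j a\<close>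
        and \<open>c p b\<close>.\<close>
      define b where "b = replace_digit r m a v w"
      have b: "b < r ^ m" using w unfolding b_def by (rule replace_digit_less)
      have ba: "replace_digit r m b v s = a"
        using w less.prems by (simp add: b_def s_def replace_digit_replace_digit replace_digit_self)
      have db: "digit r b v = w" using v w by (simp add: b_def digit_replace_digit)
      have eq_a: "vandermonde_coeff r m \<gamma> j a c =
          (if s = w then c j a else (if s < w then 1 else \<gamma>) * c j a + c p b)"
        using vandermonde_coeff_eq[OF r less.prems j', of \<gamma> c]
        by (simp add: row_weight_def v_def w_def s_def p_def b_def)
      have a0: "vandermonde_coeff r m \<gamma> j a c = 0" using coeff_zero less.prems j by simp
      show ?thesis
      proof (cases "s = w")
        case True
        then show ?thesis using eq_a a0 by simp
      next
        case False
        have eq_b: "vandermonde_coeff r m \<gamma> p b c = (if w < s then 1 else \<gamma>) * c p b + c j a"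
          using vandermonde_coeff_eq[OF r b p, of \<gamma> c] False
          by (simp add: row_weight_def p' db ba nj)
        show ?thesis
        proof (cases "p \<in> S")
          case True
          have "E b = E a"
            using v w j nj True
            by (auto simp: E_def b_def digit_replace_digit p_def s_def split: if_splits)
          then have b0: "vandermonde_coeff r m \<gamma> p b c = 0" using coeff_zero b True by simp
          \<comment> \<open>Eliminating \<open>y\<close> leaves
            \<open>(1 - \<gamma>) * x = 0\<close>. The order of \<open>s\<close> and
            \<open>w\<close> decides which unknown plays \<open>x\<close>.\<close>
          have *: "x = 0" if "x + y = 0" "\<gamma> * y + x = 0" for x y
          proof -
            have "y = - x" using that by (simp add: eq_neg_iff_add_eq_0 add.commute)
            then have "(1 - \<gamma>) * x = 0" using that by (simp add: algebra_simps)
            then show ?thesis using \<gamma> by simp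
          qed
          from False consider "s < w" | "w < s" by linarith
          then show ?thesis
          proof cases
            case 1
            then show ?thesis using *[of "c j a" "c p b"] eq_a eq_b a0 b0 by simp
          next
            case 2
            then have "c p b = 0" using *[of "c p b" "c j a"] eq_a eq_b a0 b0 by simp
            then show ?thesis using 2 eq_b b0 by simp
          qed
        next
          \<comment> \<open>Node \<open>p\<close> is intact, so \<open>c j a\<close> stands alone
            with weight 1 or \<open>\<gamma>\<close>, both nonzero.\<close>
          case pS: False
          then have "c p b = 0" using out p b by simp
          then show ?thesis using eq_a a0 False \<gamma> by (simp split: if_splits)
        qed
      qed
    qed
    then show ?case using out less.prems by blast
  qed
  then show ?thesis using \<open>i \<in> {1..r * m}\<close> by blast
qed

text \<open>
  The rows \<open>a\<close> with \<open>a\<^sub>v = u\<close> involve helper symbols only at such \<open>a\<close>, but they involve all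
  symbols of node \<open>(v, u)\<close>.
\<close>

lemma repaired_node_zero:
  assumes i: "i \<in> {1..r * m}"
    and helpers: "\<And>j a. \<lbrakk>j \<in> {1..r * m} - {i}; a < r ^ m; digit r a (block r i) = pos r i\<rbrakk> \<Longrightarrow> c j a = 0"
    and syn: "\<And>t a. \<lbrakk>t < r; a < r ^ m\<rbrakk> \<Longrightarrow> syndrome r m lam \<gamma> t a c = 0"
    and b: "b < r ^ m"
  shows "c i b = 0"
proof -
  define v where "v = block r i"
  define u where "u = pos r i"
  have v: "v \<in> {1..m}" using i unfolding v_def by (rule block_mem)
  have u: "u < r" using r unfolding u_def by (rule pos_less)
  have ni: "node r v u = i" using i by (simp add: v_def u_def node_block_pos)
  \<comment> \<open>A row of the accessed kind in which the wanted symbol occurs: restoring digit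
    \<open>v\<close> of \<open>b\<close> in \<open>a\<close> gives back \<open>b\<close>.\<close>
  define a where "a = replace_digit r m b v u"
  have a: "a < r ^ m" using u unfolding a_def by (rule replace_digit_less)
  have da: "digit r a v = u" using v u by (simp add: a_def digit_replace_digit)
  have helpers': "c j a' = 0" if "j \<in> {1..r * m} - {i}" "a' < r ^ m" "digit r a' v = u" for j a'
    using helpers that by (simp add: v_def u_def)
  \<comment> \<open>In block \<open>v\<close> each coefficient reduces to one symbol of node
    \<open>i\<close>. In other blocks only helper symbols occur, at rows whose digit
    \<open>v\<close> is still \<open>u\<close>.\<close>
  have coeff: "vandermonde_coeff r m \<gamma> j a c =
      (if block r j = v then c i (replace_digit r m a v (pos r j)) else 0)"
    if j: "j \<in> {1..r * m}" for j
  proof (cases "block r j = v")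
    case True
    show ?thesis
    proof (cases "j = i")
      case True
      then show ?thesis
        using vandermonde_coeff_eq[OF r a j, of \<gamma> c] da replace_digit_self[OF a, of v]
        by (simp flip: v_def u_def)
    next
      case False
      then have "pos r j \<noteq> u" using True j ni node_block_pos[of j r] by auto
      then show ?thesis
        using vandermonde_coeff_eq[OF r a j, of \<gamma> c] da helpers'[of j a] a j False True ni by simp
    qed
  next
    case False
    define v' where "v' = block r j"
    have v': "v' \<in> {1..m}" using j unfolding v'_def by (rule block_mem)
    have d': "digit r a v' < r" using r by (simp add: digit_def)
    define p where "p = node r v' (digit r a v')"
    define a' where "a' = replace_digit r m a v' (pos r j)"
    have "p \<in> {1..r * m}" using v' d' unfolding p_def by (rule node_mem)
    moreover have "p \<noteq> i" using False v' d' block_node[of v' "digit r a v'" r]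
      by (auto simp: p_def v_def v'_def)
    moreover have "a' < r ^ m" unfolding a'_def by (intro replace_digit_less pos_less r)
    moreover have "digit r a' v = u"
      using False v da pos_less[OF r] by (simp add: a'_def v'_def digit_replace_digit)
    ultimately have "c p a' = 0" using helpers' by simp
    moreover have "c j a = 0" using helpers'[of j a] j a da False by (auto simp: v_def)
    ultimately show ?thesis
      using vandermonde_coeff_eq[OF r a j, of \<gamma> c] False by (simp flip: v'_def p_def a'_def)
  qed
  define S where "S = {j \<in> {1..r * m}. block r j = v}"
  have S: "S = node r v ` {..<r}" unfolding S_def using r v by (rule block_eq_image)
  define j where "j = node r v (digit r b v)"
  have d: "digit r b v < r" using r by (simp add: digit_def)
  then have j: "j \<in> S" unfolding S j_def by simp
  have "card S = r" by (simp add: S card_image[OF inj_on_node])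
  then have "vandermonde_coeff r m \<gamma> j a c = 0"
    by (intro vandermonde_coeff_zero[OF _ _ syn[OF _ a] _ j]) (auto simp: S_def coeff)
  then have "c i (replace_digit r m a v (digit r b v)) = 0"
    using coeff[of j] j d by (simp add: S_def j_def pos_node)
  then show ?thesis
    using u b by (simp add: a_def replace_digit_replace_digit replace_digit_self)
qed

end

section \<open>The MDS property and repair\<close>

text \<open>Helpers send their columns with unread coordinates set to 0, and \<open>g\<close> picks
  any codeword compatible with the data; by \<open>det\<close> all of these agree in column
  \<open>i\<close>.\<close>

lemma repairable_if_determined:
  fixes C :: "(nat \<Rightarrow> 'a :: zero vec) set"
  assumes C: "C \<subseteq> {1..n} \<rightarrow>\<^sub>E carrier_vec l" and i: "i \<in> {1..n}" and R: "R \<subseteq> {1..n}"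
    and T: "\<And>j. j \<in> R \<Longrightarrow> T j \<subseteq> {0..<l}"
    and det: "\<And>c c'. \<lbrakk>c \<in> C; c' \<in> C; \<And>j a. \<lbrakk>j \<in> R; a \<in> T j\<rbrakk> \<Longrightarrow> c j $ a = c' j $ a\<rbrakk> \<Longrightarrow> c i = c' i"
  shows "repairable_by_accessing l C i R (\<Sum>j\<in>R. card (T j))"
proof -
  define f where "f j x = vec l (\<lambda>a. if a \<in> T j then x $ a else 0)" for j and x :: "'a vec"
  define F where "F c = (\<lambda>j\<in>R. f j (c j))" for c
  define P where "P y c \<longleftrightarrow> c \<in> C \<and> y = F c" for y c
  \<comment> \<open>Data of no codeword go to the zero vector, which keeps \<open>g\<close> inside
    the carrier.\<close>
  define g where "g y = (if \<exists>c. P y c then (SOME c. P y c) i else 0\<^sub>v l)" for y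
  have "depends_on_coords l (card (T j)) (f j)" if j: "j \<in> R" for j
    unfolding depends_on_coords_def
    by (rule exI[of _ "T j"]) (use T[OF j] in \<open>auto simp: f_def intro!: eq_vecI\<close>)
  moreover have "f j \<in> carrier_vec l \<rightarrow> carrier_vec l" for j
    by (simp add: f_def)
  moreover have "g y \<in> carrier_vec l" for y
  proof (cases "\<exists>c. P y c")
    case True
    then have "P y (SOME c. P y c)" by (rule someI_ex)
    then have "(SOME c. P y c) \<in> {1..n} \<rightarrow>\<^sub>E carrier_vec l" using C by (auto simp: P_def)
    from PiE_mem[OF this i] show ?thesis using True by (simp add: g_def)
  next
    case False
    then show ?thesis by (simp add: g_def)
  qed
  moreover have "c i = g (F c)" if c: "c \<in> C" for c
  proof -
    define c' where "c' = (SOME c'. P (F c) c')"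
    have ex: "\<exists>c'. P (F c) c'" using c by (auto simp: P_def)
    then have "P (F c) c'" unfolding c'_def by (rule someI_ex)
    then have c': "c' \<in> C" "F c = F c'" by (simp_all add: P_def)
    have "c j $ a = c' j $ a" if j: "j \<in> R" and a: "a \<in> T j" for j a
    proof -
      have "f j (c j) = f j (c' j)" using fun_cong[OF c'(2), of j] j by (simp add: F_def)
      from arg_cong[OF this, of "\<lambda>x. x $ a"] show ?thesis
        using T[OF j] a by (auto simp: f_def)
    qed
    then have "c i = c' i" using det c c' by blast
    then show ?thesis using ex by (simp add: g_def c'_def)
  qed
  ultimately show ?thesis
    unfolding repairable_by_accessing_def
    by (intro exI[of _ "\<lambda>_. l"] exI[of _ "\<lambda>j. card (T j)"] exI[of _ f] exI[of _ g])
      (auto simp: F_def)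
qed

locale finite_parity_check = parity_check r m lam \<gamma>
  for r m :: nat and lam :: "nat \<Rightarrow> 'a :: {field, finite}" and \<gamma>
begin

abbreviation code :: "(nat \<Rightarrow> 'a vec) set" where
  "code \<equiv> parity_code r m lam \<gamma>"

text \<open>
  A word is determined by its columns in \<open>K\<close> and its syndromes, and there are equally many
  words as such data.
\<close>

lemma restrict_code_bij:
  assumes K: "K \<subseteq> {1..r * m}" "card K = r * m - r"
  shows "bij_betw (\<lambda>c. restrict c K) code (K \<rightarrow>\<^sub>E carrier_vec (r ^ m))"
proof -
  define W :: "(nat \<Rightarrow> 'a vec) set" where "W = {1..r * m} \<rightarrow>\<^sub>E carrier_vec (r ^ m)"
  define D :: "((nat \<Rightarrow> 'a vec) \<times> (nat \<times> nat \<Rightarrow> 'a)) set"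
    where "D = (K \<rightarrow>\<^sub>E carrier_vec (r ^ m)) \<times> (({..<r} \<times> {..<r ^ m}) \<rightarrow>\<^sub>E UNIV)"
  define syn where "syn c = (\<lambda>(t, a)\<in>{..<r} \<times> {..<r ^ m}.
    syndrome r m lam \<gamma> t a (\<lambda>i b. c i $ b))" for c
  define h where "h c = (restrict c K, syn c)" for c
  have finK: "finite K" using K finite_subset by blast
  have le: "r \<le> r * m" using m by simp
  have code: "code = {c \<in> W. \<forall>t<r. \<forall>a<r ^ m. syndrome r m lam \<gamma> t a (\<lambda>i b. c i $ b) = 0}"
    using parity_code_iff[OF r, of _ m lam \<gamma>] by (auto simp: W_def)
  \<comment> \<open>The difference of two words with the same image has zero syndromes and vanishes
    on \<open>K\<close>, so only \<open>r\<close> nodes are erased.\<close>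
  have inj: "inj_on h W"
  proof (rule inj_onI)
    fix c c' assume c: "c \<in> W" and c': "c' \<in> W" and eq: "h c = h c'"
    have eqK: "restrict c K = restrict c' K" and eqsyn: "syn c = syn c'"
      using eq by (simp_all add: h_def)
    have zero: "c i $ a - c' i $ a = 0" if i: "i \<in> {1..r * m}" and a: "a < r ^ m" for i a
    proof (rule erased_nodes_zero[where S = "{1..r * m} - K" and c = "\<lambda>i a. c i $ a - c' i $ a",
          OF _ _ _ _ i a])
      show "card ({1..r * m} - K) = r"
        using K finK le by (simp add: card_Diff_subset)
      show "c j $ b - c' j $ b = 0" if "j \<in> {1..r * m} - ({1..r * m} - K)" for j b
        using fun_cong[OF eqK, of j] that by auto
      show "syndrome r m lam \<gamma> t b (\<lambda>i a. c i $ a - c' i $ a) = 0" if "t < r" "b < r ^ m" for t b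
        using fun_cong[OF eqsyn, of "(t, b)"] that by (simp add: syndrome_diff syn_def)
    qed auto
    show "c = c'"
    proof (rule PiE_ext)
      show "c \<in> {1..r * m} \<rightarrow>\<^sub>E carrier_vec (r ^ m)" "c' \<in> {1..r * m} \<rightarrow>\<^sub>E carrier_vec (r ^ m)"
        using c c' by (simp_all add: W_def)
      fix i assume i: "i \<in> {1..r * m}"
      then have "c i \<in> carrier_vec (r ^ m)" "c' i \<in> carrier_vec (r ^ m)"
        using c c' unfolding W_def by blast+
      then show "c i = c' i" using zero[OF i] by (intro eq_vecI) auto
    qed
  qed
  have img: "h ` W = D"
  proof (rule card_subset_eq)
    show "finite D"
      using finK finite_carrier_vec unfolding D_def by (intro finite_SigmaI finite_PiE) auto
    show "h ` W \<subseteq> D"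
      using K unfolding h_def D_def W_def syn_def by (auto simp: subset_iff PiE_iff)
    have "card D = CARD('a) ^ (r ^ m * (r * m - r) + r * r ^ m)"
      using K finK by (simp add: D_def card_cartesian_product card_PiE card_carrier_vec
          power_add flip: power_mult)
    also have "r ^ m * (r * m - r) + r * r ^ m = r ^ m * (r * m)"
      using le by (simp add: algebra_simps flip: distrib_left)
    also have "CARD('a) ^ (r ^ m * (r * m)) = card (h ` W)"
      unfolding card_image[OF inj] by (simp add: W_def card_PiE card_carrier_vec flip: power_mult)
    finally show "card (h ` W) = card D" ..
  qed
  \<comment> \<open>The code is the part of \<open>W\<close> with syndrome data \<open>z\<close>, so
    the bijection \<open>h\<close> restricts to it.\<close>
  define z where "z = (\<lambda>_\<in>{..<r} \<times> {..<r ^ m}. 0 :: 'a)"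
  have code_z: "c \<in> code \<longleftrightarrow> c \<in> W \<and> syn c = z" for c
  proof -
    have "syn c = z \<longleftrightarrow> (\<forall>t<r. \<forall>a<r ^ m. syndrome r m lam \<gamma> t a (\<lambda>i b. c i $ b) = 0)"
      unfolding syn_def z_def fun_eq_iff restrict_def by auto
    then show ?thesis by (simp add: code)
  qed
  show ?thesis
  proof (rule bij_betw_imageI)
    show "inj_on (\<lambda>c. restrict c K) code"
      using inj by (auto simp: inj_on_def code_z h_def)
    show "(\<lambda>c. restrict c K) ` code = K \<rightarrow>\<^sub>E carrier_vec (r ^ m)"
    proof (intro equalityI subsetI)
      fix y assume "y \<in> (\<lambda>c. restrict c K) ` code"
      then show "y \<in> K \<rightarrow>\<^sub>E carrier_vec (r ^ m)"
        using K unfolding code W_def by (auto simp: subset_iff PiE_iff)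
    next
      fix y :: "nat \<Rightarrow> 'a vec" assume "y \<in> K \<rightarrow>\<^sub>E carrier_vec (r ^ m)"
      then have "(y, z) \<in> D" by (simp add: D_def z_def)
      then obtain c where "c \<in> W" "h c = (y, z)" unfolding img[symmetric] by auto
      then show "y \<in> (\<lambda>c. restrict c K) ` code" by (auto simp: code_z h_def)
    qed
  qed
qed

theorem mds_parity_code: "mds_array_code (r * m) (r * m - r) (r ^ m) code"
  unfolding mds_array_code_def array_code_def
proof (intro conjI allI impI)
  show "code \<subseteq> {1..r * m} \<rightarrow>\<^sub>E carrier_vec (r ^ m)" by (auto simp: parity_code_def)
  have "{1..r * m - r} \<subseteq> {1..r * m}" by auto
  from bij_betw_same_card[OF restrict_code_bij[OF this]]
  show "card code = CARD('a) ^ ((r * m - r) * r ^ m)"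
    by (simp add: card_PiE card_carrier_vec mult.commute flip: power_mult)
next
  fix K assume K: "K \<subseteq> {1..r * m} \<and> card K = r * m - r"
  then have inj: "inj_on (\<lambda>c. restrict c K) code"
    using restrict_code_bij by (simp add: bij_betw_def)
  have "\<forall>c\<in>code. restrict c ({1..r * m} - K) =
      restrict (the_inv_into code (\<lambda>c. restrict c K) (restrict c K)) ({1..r * m} - K)"
    using the_inv_into_f_f[OF inj] by simp
  then show "\<exists>g. \<forall>c\<in>code. restrict c ({1..r * m} - K) = g (restrict c K)"
    by (rule exI[of _ "\<lambda>y. restrict (the_inv_into code (\<lambda>c. restrict c K) y) ({1..r * m} - K)"])
qed simp

text \<open>By \<open>repaired_node_zero\<close>, applied to differences of codewords, the rows in
  \<open>T\<close>, the same for every helper, determine node \<open>i\<close>.\<close>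

lemma repairable_parity_code:
  assumes i: "i \<in> {1..r * m}"
  shows "repairable_by_accessing (r ^ m) code i ({1..r * m} - {i}) ((r * m - 1) * r ^ (m - 1))"
proof -
  define T where "T = {a. a < r ^ m \<and> digit r a (block r i) = pos r i}"
  have code: "code \<subseteq> {1..r * m} \<rightarrow>\<^sub>E carrier_vec (r ^ m)" by (auto simp: parity_code_def)
  have "repairable_by_accessing (r ^ m) code i ({1..r * m} - {i}) (\<Sum>j\<in>{1..r * m} - {i}. card T)"
  proof (rule repairable_if_determined[OF code i])
    fix c c' assume c: "c \<in> code" "c' \<in> code"
      and eq: "\<And>j a. \<lbrakk>j \<in> {1..r * m} - {i}; a \<in> T\<rbrakk> \<Longrightarrow> c j $ a = c' j $ a"
    have "c i $ a - c' i $ a = 0" if "a < r ^ m" for a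
    proof (rule repaired_node_zero[where c = "\<lambda>i a. c i $ a - c' i $ a", OF i _ _ that])
      show "syndrome r m lam \<gamma> t b (\<lambda>i a. c i $ a - c' i $ a) = 0" if "t < r" "b < r ^ m" for t b
        using c that by (simp add: syndrome_diff parity_code_iff[OF r])
    qed (use eq in \<open>auto simp: T_def\<close>)
    moreover have "c i \<in> carrier_vec (r ^ m)" "c' i \<in> carrier_vec (r ^ m)"
      using c code i by blast+
    ultimately show "c i = c' i" by (intro eq_vecI) auto
  qed (auto simp: T_def)
  moreover have "card T = r ^ (m - 1)"
    unfolding T_def using i r by (intro card_digit_eq block_mem pos_less)
  ultimately show ?thesis using i by simp
qed

lemma min_access_parity_code:
  assumes k: "1 \<le> r * m - r \<or> r = 1" and i: "i \<in> {1..r * m}"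
  shows "min_access (r ^ m) code i ({1..r * m} - {i}) = (r * m - 1) * r ^ (m - 1)"
  unfolding min_access_def
proof (rule Least_equality)
  show "repairable_by_accessing (r ^ m) code i ({1..r * m} - {i}) ((r * m - 1) * r ^ (m - 1))"
    using i by (rule repairable_parity_code)
next
  fix \<omega> assume rep: "repairable_by_accessing (r ^ m) code i ({1..r * m} - {i}) \<omega>"
  have card: "card ({1..r * m} - {i}) = r * m - 1" using i by simp
  show "(r * m - 1) * r ^ (m - 1) \<le> \<omega>"
  proof (cases "1 \<le> r * m - r")
    case True
    have "r * m - r \<le> r * m - 1" using r by simp
    then have "(r * m - 1) * r ^ m \<le> (r * m - 1 + 1 - (r * m - r)) * \<omega>"
      using mds_access_lower_bound[OF mds_parity_code True i _ _ rep] card by simp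
    also have "r * m - 1 + 1 - (r * m - r) = r" using True by simp
    also have "r ^ m = r * r ^ (m - 1)" using m by (cases m) simp_all
    finally have "r * ((r * m - 1) * r ^ (m - 1)) \<le> r * \<omega>"
      by (simp add: mult.left_commute)
    then show ?thesis using r by simp
  next
    \<comment> \<open>Then \<open>r = 1\<close> and \<open>m = 1\<close>: a single node without
      helpers, and the bound is 0.\<close>
    case False
    then have "r * m - 1 = 0" using k by auto
    then show ?thesis by simp
  qed
qed

end

text \<open>Every node needs \<open>(n - 1) * r ^ (m - 1)\<close> symbols, which is
  \<open>(n - 1) * l / r\<close>. The assumption \<open>k \<ge> 1 \<or> r = 1\<close> excludes
  \<open>m = 1\<close> with \<open>r > 1\<close>: there the code has one word and repair costs
  nothing, while the required value is \<open>r - 1\<close>.\<close>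

theorem theorem6:
  fixes r m n k l :: nat
    and lam :: "nat \<Rightarrow> 'a :: {field, finite}"
    and \<gamma> :: 'a
  assumes "r \<ge> 1" and "m \<ge> 1"
    and "n = r * m" and "k = n - r" and "l = r ^ m"
    and "k \<ge> 1 \<or> r = 1"
    and "CARD('a) \<ge> n"
    and "inj_on lam {1..n}"
    and "\<gamma> \<noteq> 0" and "\<gamma> \<noteq> 1"
  shows "optimal_access n k l (parity_code r m lam \<gamma>)"
proof -
  interpret finite_parity_check r m lam \<gamma>
    using assms by unfold_locales simp_all
  have le: "r \<le> n" using assms by simp
  have "(\<lambda>i. min_access l code i ({1..n} - {i})) ` {1..n} = (\<lambda>_. (n - 1) * r ^ (m - 1)) ` {1..n}"
    using min_access_parity_code assms by (intro image_cong) auto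
  also have "\<dots> = {(n - 1) * r ^ (m - 1)}" using assms(1) le by auto
  finally have "Max ((\<lambda>i. min_access l code i ({1..n} - {i})) ` {1..n}) = (n - 1) * r ^ (m - 1)"
    by simp
  then have "code_access n l code = (n - 1) * r ^ (m - 1)"
    by (simp add: code_access_def)
  moreover have "real l = real r * real r ^ (m - 1)"
    using assms(2,5) by (cases m) simp_all
  moreover have "real n - real k = real r"
    unfolding \<open>k = n - r\<close> using le by (simp add: of_nat_diff)
  moreover have "real (n - 1) = real n - 1"
    using assms(1) le by (simp add: of_nat_diff)
  ultimately have "real (code_access n l code) = (real n - 1) * real l / (real n - real k)"
    using assms(1) by simp
  then show ?thesis
    using mds_parity_code assms by (simp add: optimal_access_def)
qed

end
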